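(* Let $A$ be a subset of $\mathbb{Z}_+=\{0,1,2,\dots\}$ such that there exist $B\subset\mathbb{Z}$ and $n\in\mathbb{N}$ with $A\oplus B=\{0,\dots,n-1\}$. Then $A$ is a spectral set.
   Context: The notation $A\oplus B=C$ means $C=A+B$ and every $c\in C$ can be written uniquely as $c=a+b$ with $a\in A$, $b\in B$. A finite set $A\subset\mathbb{R}$ is spectral if there is a set $\Lambda\subset\mathbb{R}$ such that the family of functions $e_\lambda(x)=e^{2\pi i\lambda x}$, $\lambda\in\Lambda$, is an orthogonal basis of $L^2(\delta_A)$, where $\delta_A=\frac{1}{\#A}\sum_{a\in A}\delta_a$ ($\delta_a$ the Dirac measure at $a$). Here $\mathbb{N}=\{1,2,\dots\}$. *)

theory Defs
  imports "HOL-Probability.Probability"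
begin

definition direct_sum :: "'a::plus set \<Rightarrow> 'a set \<Rightarrow> 'a set \<Rightarrow> bool"
  where "direct_sum A B C \<longleftrightarrow>
    C = {a + b | a b. a \<in> A \<and> b \<in> B} \<and>
    (\<forall>c\<in>C. \<exists>!p. p \<in> A \<times> B \<and> c = fst p + snd p)"

text \<open>The elements of \<open>L\<^sup>2(M)\<close> are represented by functions rather than by classes of
  functions up to equality almost everywhere; all notions below respect that relation.\<close>

definition L2 :: "'a measure \<Rightarrow> ('a \<Rightarrow> complex) set"
  where "L2 M = {f \<in> borel_measurable M. integrable M (\<lambda>x. (cmod (f x))\<^sup>2)}"

definition L2_inner :: "'a measure \<Rightarrow> ('a \<Rightarrow> complex) \<Rightarrow> ('a \<Rightarrow> complex) \<Rightarrow> complex"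
  where "L2_inner M f g = (\<integral>x. f x * cnj (g x) \<partial>M)"

definition L2_norm :: "'a measure \<Rightarrow> ('a \<Rightarrow> complex) \<Rightarrow> real"
  where "L2_norm M f = sqrt (\<integral>x. (cmod (f x))\<^sup>2 \<partial>M)"

text \<open>An orthogonal basis in the Hilbert space sense: nonzero, pairwise orthogonal vectors whose
  linear span is dense. It is a property of the indexed family, so distinct indices must give
  orthogonal, hence distinct, elements.\<close>

definition L2_orthogonal_basis :: "'a measure \<Rightarrow> ('i \<Rightarrow> 'a \<Rightarrow> complex) \<Rightarrow> 'i set \<Rightarrow> bool"
  where "L2_orthogonal_basis M e I \<longleftrightarrow>
    (\<forall>i\<in>I. e i \<in> L2 M \<and> L2_norm M (e i) \<noteq> 0) \<and>
    (\<forall>i\<in>I. \<forall>j\<in>I. i \<noteq> j \<longrightarrow> L2_inner M (e i) (e j) = 0) \<and>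
    (\<forall>f\<in>L2 M. \<forall>\<epsilon>>0. \<exists>F c. finite F \<and> F \<subseteq> I \<and>
       L2_norm M (\<lambda>x. f x - (\<Sum>i\<in>F. c i * e i x)) < \<epsilon>)"

text \<open>The library writes the Dirac measure at \<open>a\<close> on the Borel sets as \<open>return borel a\<close>.\<close>

definition delta :: "real set \<Rightarrow> real measure"
  where "delta A = measure_of UNIV (sets borel)
    (\<lambda>X. ennreal (1 / real (card A)) * (\<Sum>a\<in>A. emeasure (return borel a) X))"

definition expo :: "real \<Rightarrow> real \<Rightarrow> complex"
  where "expo l x = exp (2 * complex_of_real pi * \<i> * complex_of_real l * complex_of_real x)"

text \<open>The empty set, for which \<open>delta\<close> would be meaningless, is excluded.\<close>

definition spectral :: "real set \<Rightarrow> bool"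
  where "spectral A \<longleftrightarrow> finite A \<and> A \<noteq> {} \<and> (\<exists>\<Lambda>. L2_orthogonal_basis (delta A) expo \<Lambda>)"

lemma sets_delta [simp, measurable_cong]: "sets (delta A) = sets borel"
  and space_delta [simp]: "space (delta A) = UNIV"
  by (simp_all add: delta_def sets.sigma_sets_eq[of borel, simplified] space_measure_of_conv)

text \<open>The set function in the definition of \<open>delta\<close> is a measure, so that \<open>measure_of\<close> keeps it.\<close>

lemma emeasure_delta:
  assumes "X \<in> sets borel"
  shows "emeasure (delta A) X =
    ennreal (1 / real (card A)) * (\<Sum>a\<in>A. emeasure (return borel a) X)"
proof (rule emeasure_measure_of[OF delta_def])
  show "countably_additive (sets (delta A))
     (\<lambda>X. ennreal (1 / real (card A)) * (\<Sum>a\<in>A. emeasure (return borel a) X))"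
  proof (rule countably_additiveI)
    fix S :: "nat \<Rightarrow> real set"
    assume S: "range S \<subseteq> sets (delta A)" "disjoint_family S"
    have "(\<Sum>i. emeasure (return borel a) (S i)) = emeasure (return borel a) (\<Union>i. S i)" for a
      using S by (intro suminf_emeasure) auto
    then show "(\<Sum>i. ennreal (1 / real (card A)) * (\<Sum>a\<in>A. emeasure (return borel a) (S i))) =
      ennreal (1 / real (card A)) * (\<Sum>a\<in>A. emeasure (return borel a) (\<Union>i. S i))"
      by (simp add: suminf_sum del: emeasure_return)
  qed
qed (use assms in \<open>auto simp: positive_def\<close>)

lemma integral_delta:
  fixes f :: "real \<Rightarrow> complex"
  assumes A: "finite A" "A \<noteq> {}" and f: "f \<in> borel_measurable borel"
  shows "(\<integral>x. f x \<partial>delta A) = (\<Sum>a\<in>A. f a) / of_nat (card A)"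
proof -
  let ?U = "uniform_count_measure A"
  have id: "(\<lambda>x. x) \<in> ?U \<rightarrow>\<^sub>M borel"
    by (auto simp: measurable_def space_uniform_count_measure sets_uniform_count_measure)
  have "delta A = distr ?U borel (\<lambda>x. x)"
  proof (rule measure_eqI)
    fix X assume "X \<in> sets (delta A)"
    then have X: "X \<in> sets borel" by simp
    have "(\<Sum>a\<in>A. emeasure (return borel a) X) = (\<Sum>a\<in>A. ennreal (indicator X a))"
      using X by (intro sum.cong) (auto simp: indicator_def)
    also have "\<dots> = ennreal (real (card (X \<inter> A)))"
      using A by (subst sum_ennreal) (auto simp: indicator_def sum.If_cases Int_commute)
    finally show "emeasure (delta A) X = emeasure (distr ?U borel (\<lambda>x. x)) X"
      using X A id by (simp add: emeasure_delta emeasure_distr emeasure_uniform_count_measure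
          space_uniform_count_measure ennreal_mult'[symmetric])
  qed simp
  then have "(\<integral>x. f x \<partial>delta A) = (\<integral>x. f x \<partial>?U)"
    using f id by (simp add: integral_distr)
  also have "\<dots> = (\<Sum>a\<in>A. f a) / of_nat (card A)"
    using A by (simp add: uniform_count_measure_def lebesgue_integral_point_measure_finite
        scaleR_conv_of_real sum_divide_distrib)
  finally show ?thesis .
qed

end

theory Submission
  imports Defs
begin

text \<open>Translate so that \<open>0 \<in> A \<inter> B\<close>. By de Bruijn's theorem on tilings of intervals,
  if \<open>A \<oplus> B = {0..<n}\<close> and, say, \<open>1 \<in> A\<close>, then \<open>A = {0..<m} \<oplus> m A'\<close> and \<open>B = m B'\<close>, where \<open>A' \<oplus> B'\<close> is a shorter interval. Hence
  \<open>A\<close> is built from singletons by dilations and by the operation \<open>A' \<mapsto> {0..<m} \<oplus> m A'\<close>. If \<open>L\<close> is a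
  spectrum of \<open>A'\<close>, then \<open>L / m\<close> is one of \<open>m A'\<close> and \<open>{0..<m} / m + L / m\<close> is one of
  \<open>{0..<m} \<oplus> m A'\<close>. Completeness is obtained by carrying along the dual orthogonality
  relations, in which the set and the spectrum are exchanged.\<close>

section \<open>Algebra of the exponentials\<close>

lemma expo_commute: "expo l x = expo x l"
  by (simp add: expo_def mult_ac)

lemma expo_cong: "k * x = l * y \<Longrightarrow> expo k x = expo l y"
  by (simp add: expo_def mult.assoc of_real_mult[symmetric] del: of_real_mult)

lemma expo_add_left: "expo (k + l) x = expo k x * expo l x"
  by (simp add: expo_def exp_add[symmetric] algebra_simps)

lemma expo_add_right: "expo l (x + y) = expo l x * expo l y"
  by (simp add: expo_def exp_add[symmetric] algebra_simps)

lemma expo_zero [simp]: "expo 0 x = 1" "expo l 0 = 1"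
  by (simp_all add: expo_def)

lemma cnj_expo: "cnj (expo l x) = expo (- l) x"
  by (simp add: expo_def exp_cnj)

lemma expo_minus: "expo l (- x) = expo (- l) x"
  by (simp add: expo_def)

lemma norm_expo [simp]: "cmod (expo l x) = 1"
  by (simp add: expo_def)

lemma expo_eq_1_iff: "expo l x = 1 \<longleftrightarrow> l * x \<in> \<int>"
proof -
  have "expo l x = 1 \<longleftrightarrow> (\<exists>n::int. 2 * pi * l * x = of_int (2 * n) * pi)"
    by (simp add: expo_def exp_eq_1 algebra_simps)
  also have "\<dots> \<longleftrightarrow> (\<exists>n::int. l * x = of_int n)"
    by (simp add: algebra_simps)
  finally show ?thesis
    by (auto elim: Ints_cases)
qed

lemma expo_of_nat: "expo l (of_nat n) = expo l 1 ^ n"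
  by (simp add: expo_def exp_of_nat_mult[symmetric] mult_ac)

lemma borel_measurable_expo [measurable]: "expo l \<in> borel_measurable borel"
  unfolding expo_def by (intro borel_measurable_continuous_onI continuous_intros)

section \<open>Spectral pairs\<close>

text \<open>For finite nonempty \<open>A\<close> the sum is \<open>card A\<close> times the inner
  product of \<open>expo k\<close> and \<open>expo l\<close> over \<open>delta A\<close>, because
  conjugation turns \<open>expo l\<close> into \<open>expo (- l)\<close>.\<close>

definition orthogonal_on :: "real set \<Rightarrow> real set \<Rightarrow> bool"
  where "orthogonal_on A L \<longleftrightarrow> (\<forall>k\<in>L. \<forall>l\<in>L. k \<noteq> l \<longrightarrow> (\<Sum>a\<in>A. expo (k - l) a) = 0)"

text \<open>The matrix with entries \<open>expo l a\<close> has orthogonal rows and orthogonal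
  columns. Keeping both makes the notion symmetric and replaces a comparison of
  \<open>card A\<close> with \<open>card L\<close>.\<close>

definition spectral_pair :: "real set \<Rightarrow> real set \<Rightarrow> bool"
  where "spectral_pair A L \<longleftrightarrow> finite A \<and> A \<noteq> {} \<and> finite L \<and> L \<noteq> {} \<and>
    orthogonal_on A L \<and> orthogonal_on L A"

lemma spectral_pair_singleton: "spectral_pair {a} {l}"
  by (simp add: spectral_pair_def orthogonal_on_def)

lemma orthogonal_on_scale:
  assumes "orthogonal_on A L" "c \<noteq> 0"
  shows "orthogonal_on ((*) c ` A) ((*) (1 / c) ` L)"
proof -
  have "(\<Sum>a\<in>(*) c ` A. expo (k / c - l / c) a) = (\<Sum>a\<in>A. expo (k - l) a)" for k l
    using assms(2) by (subst sum.reindex)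
      (auto simp: inj_on_def diff_divide_distrib[symmetric] intro!: sum.cong expo_cong)
  then show ?thesis
    using assms by (auto simp: orthogonal_on_def)
qed

lemma spectral_pair_scale:
  assumes "spectral_pair A L" "c \<noteq> 0"
  shows "spectral_pair ((*) c ` A) ((*) (1 / c) ` L)"
  using assms orthogonal_on_scale[of A L c] orthogonal_on_scale[of L A "1 / c"]
  by (simp add: spectral_pair_def)

text \<open>A shift of \<open>A\<close> multiplies each exponential sum over \<open>A\<close> by a
  phase, while the dual relations see only differences of elements of \<open>A\<close>.\<close>

lemma spectral_pair_translate:
  assumes "spectral_pair A L"
  shows "spectral_pair ((+) t ` A) L"
proof -
  have "(\<Sum>a\<in>(+) t ` A. expo l a) = expo l t * (\<Sum>a\<in>A. expo l a)" for l
    by (subst sum.reindex) (auto simp: expo_add_right sum_distrib_left)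
  then show ?thesis
    using assms by (auto simp: spectral_pair_def orthogonal_on_def)
qed

section \<open>Sumsets of spectral pairs\<close>

definition sumset :: "'a::plus set \<Rightarrow> 'a set \<Rightarrow> 'a set"
  where "sumset A B = (\<lambda>(a, b). a + b) ` (A \<times> B)"

lemma sumset_commute: "sumset A B = sumset B (A :: 'a::ab_semigroup_add set)"
proof -
  have "sumset A B \<subseteq> sumset B A" for A B :: "'a set"
    by (auto simp: sumset_def image_iff) (metis add.commute)
  then show ?thesis
    by blast
qed

text \<open>Two representations with different components in \<open>L\<close> would make the exponential of their
  difference, which has mean zero on \<open>A\<close>, equal to \<open>1\<close> there.\<close>

lemma inj_on_sumset:
  assumes "orthogonal_on A L" "finite A" "A \<noteq> {}"
    and "\<And>k a. k \<in> K \<Longrightarrow> a \<in> A \<Longrightarrow> expo k a = 1"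
  shows "inj_on (\<lambda>(k, l). k + l) (K \<times> L)"
proof -
  have "l = l'" if *: "k \<in> K" "k' \<in> K" "l \<in> L" "l' \<in> L" "k + l = k' + l'" for k k' l l'
  proof (rule ccontr)
    assume "l \<noteq> l'"
    then have "(\<Sum>a\<in>A. expo (l - l') a) = 0"
      using assms(1) * by (auto simp: orthogonal_on_def)
    moreover have "expo (l - l') a = 1" if "a \<in> A" for a
    proof -
      have "expo k' a = expo (l - l' + k) a"
        using * by (simp add: algebra_simps)
      then show ?thesis
        using assms(4) * that by (simp add: expo_add_left)
    qed
    ultimately show False
      using assms(2,3) by simp
  qed
  then show ?thesis
    by (fastforce simp: inj_on_def)
qed

text \<open>The exponential sum factors into a sum over \<open>A\<close> and a sum over
  \<open>B\<close>. By \<open>cross\<close> the sum over \<open>B\<close> sees only the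
  \<open>L\<close>-part of the frequency, so it vanishes when the \<open>L\<close>-parts differ;
  when they agree, the sum over \<open>A\<close> has a nonzero frequency from \<open>K\<close> and
  vanishes.\<close>

lemma orthogonal_on_sumset:
  assumes "orthogonal_on A K" "orthogonal_on B L"
    and inj: "inj_on (\<lambda>(a, b). a + b) (A \<times> B)"
    and cross: "\<And>k b. k \<in> K \<Longrightarrow> b \<in> B \<Longrightarrow> expo k b = 1"
  shows "orthogonal_on (sumset A B) (sumset K L)"
  unfolding orthogonal_on_def
proof (intro ballI impI)
  fix x y assume "x \<in> sumset K L" "y \<in> sumset K L" and ne: "x \<noteq> y"
  then obtain k l k' l' where *: "k \<in> K" "l \<in> L" "k' \<in> K" "l' \<in> L" "x = k + l" "y = k' + l'"
    by (auto simp: sumset_def)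
  have cross': "expo (x - y) b = expo (l - l') b" if "b \<in> B" for b
  proof -
    \<comment> \<open>The factor \<open>expo k' b\<close> is \<open>1\<close>; it cancels the
      \<open>- k'\<close> in the frequency, so that \<open>cross\<close> is needed only for elements
      of \<open>K\<close> and not for their negatives.\<close>
    have "expo (x - y) b * expo k' b = expo (x - y + k') b"
      by (simp add: expo_add_left)
    also have "\<dots> = expo (k + (l - l')) b"
      using * by (simp add: algebra_simps)
    finally show ?thesis
      using cross * that by (simp add: expo_add_left)
  qed
  have "(\<Sum>c\<in>sumset A B. expo (x - y) c) = (\<Sum>(a, b)\<in>A \<times> B. expo (x - y) a * expo (x - y) b)"
    unfolding sumset_def using inj
    by (subst sum.reindex) (auto simp: expo_add_right case_prod_unfold)
  also have "\<dots> = (\<Sum>a\<in>A. expo (x - y) a) * (\<Sum>b\<in>B. expo (x - y) b)"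
    by (simp add: sum_product sum.cartesian_product)
  also have "\<dots> = (\<Sum>a\<in>A. expo (x - y) a) * (\<Sum>b\<in>B. expo (l - l') b)"
    using cross' by simp
  also have "\<dots> = 0"
  proof (cases "l = l'")
    case True
    then have "x - y = k - k'" "k \<noteq> k'"
      using * ne by auto
    then show ?thesis
      using assms(1) * by (auto simp: orthogonal_on_def)
  next
    case False
    then show ?thesis
      using assms(2) * by (auto simp: orthogonal_on_def)
  qed
  finally show "(\<Sum>c\<in>sumset A B. expo (x - y) c) = 0" .
qed

text \<open>The condition \<open>cross\<close> is symmetric because \<open>expo\<close> is. The dual
  relations are therefore \<open>orthogonal_on_sumset\<close> once more, with \<open>A\<close>,
  \<open>B\<close>, \<open>K\<close>, \<open>L\<close> replaced by \<open>L\<close>,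
  \<open>K\<close>, \<open>B\<close>, \<open>A\<close>.\<close>

lemma spectral_pair_sumset:
  assumes "spectral_pair A K" "spectral_pair B L"
    and cross: "\<And>k b. k \<in> K \<Longrightarrow> b \<in> B \<Longrightarrow> expo k b = 1"
  shows "spectral_pair (sumset A B) (sumset K L)"
proof -
  have cross': "expo b k = 1" if "b \<in> B" "k \<in> K" for b k
    using cross[OF that(2,1)] by (simp add: expo_commute[of b])
  have "inj_on (\<lambda>(b, a). b + a) (B \<times> A)"
    using assms cross' by (intro inj_on_sumset[of K]) (auto simp: spectral_pair_def)
  then have "inj_on (\<lambda>(a, b). a + b) (A \<times> B)"
    by (fastforce simp: inj_on_def add.commute)
  moreover have "inj_on (\<lambda>(k, l). k + l) (K \<times> L)"
    using assms by (intro inj_on_sumset[of B]) (auto simp: spectral_pair_def)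
  then have "inj_on (\<lambda>(l, k). l + k) (L \<times> K)"
    by (fastforce simp: inj_on_def add.commute)
  ultimately have "orthogonal_on (sumset A B) (sumset K L)"
    "orthogonal_on (sumset L K) (sumset B A)"
    using assms cross' by (auto intro!: orthogonal_on_sumset simp: spectral_pair_def)
  then show ?thesis
    using assms by (auto simp: spectral_pair_def sumset_commute[of L K] sumset_commute[of B A])
      (auto simp: sumset_def)
qed

section \<open>Spectra of intervals\<close>

text \<open>A geometric sum whose ratio is an \<open>m\<close>-th root of unity other than
  \<open>1\<close>.\<close>

lemma sum_expo_interval:
  assumes "\<not> int m dvd d" "m > 0"
  shows "(\<Sum>j<m. expo (of_int d / of_nat m) (of_nat j)) = 0"
proof -
  define z where "z = expo (of_int d / of_nat m) 1"
  have "z ^ m = 1"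
    using assms(2) unfolding z_def by (simp add: expo_of_nat[symmetric] expo_eq_1_iff)
  moreover have "z \<noteq> 1"
  proof
    assume "z = 1"
    then obtain q where "real_of_int d / of_nat m = of_int q"
      unfolding z_def expo_eq_1_iff by (auto elim: Ints_cases)
    then have "real_of_int d = of_int (int m * q)"
      using assms(2) by (simp add: field_simps)
    then have "d = int m * q"
      by (simp only: of_int_eq_iff)
    then show False
      using assms(1) by simp
  qed
  ultimately have "(\<Sum>j<m. z ^ j) = 0"
    by (simp add: geometric_sum)
  then show ?thesis
    by (simp add: z_def expo_of_nat[symmetric])
qed

lemma spectral_pair_interval:
  assumes "m > 0"
  shows "spectral_pair (real ` {..<m}) ((\<lambda>j. real j / real m) ` {..<m})"
proof -
  have *: "(\<Sum>j<m. expo ((real x - real y) / real m) (real j)) = 0"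
    if "x < m" "y < m" "x \<noteq> y" for x y
  proof -
    \<comment> \<open>Distinct indices below \<open>m\<close> differ by less than \<open>m\<close>
      in absolute value.\<close>
    have "\<not> int m dvd (int x - int y)"
      using that zdvd_not_zless[of "\<bar>int x - int y\<bar>" "int m"] by auto
    from sum_expo_interval[OF this assms] show ?thesis
      by simp
  qed
  \<comment> \<open>The factor \<open>1 / m\<close> may sit in either argument, so the same sums
    settle the dual relations.\<close>
  have "expo (real x - real y) (real j / real m) = expo ((real x - real y) / real m) (real j)"
    for x y j
    by (simp add: expo_def)
  with * show ?thesis
    using assms by (auto simp: spectral_pair_def orthogonal_on_def sum.reindex inj_on_def
        diff_divide_distrib[symmetric])
qed

section \<open>From spectral pairs to orthogonal bases\<close>

lemma finite_measure_delta: "finite_measure (delta A)"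
  by (rule finite_measureI) (auto simp: emeasure_delta ennreal_mult_eq_top_iff)

lemma integral_delta_real:
  fixes f :: "real \<Rightarrow> real"
  assumes "finite A" "A \<noteq> {}" "f \<in> borel_measurable borel"
  shows "(\<integral>x. f x \<partial>delta A) = (\<Sum>a\<in>A. f a) / of_nat (card A)"
proof -
  have "complex_of_real (\<integral>x. f x \<partial>delta A) = (\<integral>x. complex_of_real (f x) \<partial>delta A)"
    by simp
  also have "\<dots> = complex_of_real ((\<Sum>a\<in>A. f a) / of_nat (card A))"
    using assms by (subst integral_delta) auto
  finally show ?thesis
    by (simp only: of_real_eq_iff)
qed

text \<open>Fourier inversion: after exchanging the sums, dual orthogonality kills the inner sum
  over \<open>L\<close> unless \<open>a = x\<close>, where it equals \<open>card L\<close>.\<close>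

lemma spectral_pair_expansion:
  assumes "spectral_pair A L" "x \<in> A"
  shows "f x = (\<Sum>l\<in>L. ((\<Sum>a\<in>A. f a * expo (- l) a) / of_nat (card L)) * expo l x)"
proof -
  have fin: "finite A" "finite L" "L \<noteq> {}" and orth: "orthogonal_on L A"
    using assms by (auto simp: spectral_pair_def)
  have "(\<Sum>l\<in>L. (\<Sum>a\<in>A. f a * expo (- l) a) * expo l x)
      = (\<Sum>l\<in>L. \<Sum>a\<in>A. f a * expo (x - a) l)"
  proof (intro sum.cong refl)
    fix l
    have "expo (- l) a * expo l x = expo (x - a) l" for a
    proof -
      have "expo (- l) a * expo l x = expo l (- a + x)"
        by (simp only: expo_minus expo_add_right)
      also have "\<dots> = expo (x - a) l"
        by (rule expo_cong) simp
      finally show ?thesis .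
    qed
    then show "(\<Sum>a\<in>A. f a * expo (- l) a) * expo l x = (\<Sum>a\<in>A. f a * expo (x - a) l)"
      by (simp add: sum_distrib_right mult.assoc)
  qed
  also have "\<dots> = (\<Sum>a\<in>A. f a * (\<Sum>l\<in>L. expo (x - a) l))"
    by (subst sum.swap) (simp add: sum_distrib_left)
  also have "\<dots> = (\<Sum>a\<in>A. if a = x then f x * of_nat (card L) else 0)"
    using orth assms(2) by (intro sum.cong) (auto simp: orthogonal_on_def)
  also have "\<dots> = f x * of_nat (card L)"
    using fin assms(2) by simp
  finally show ?thesis
    using fin by (simp add: sum_divide_distrib[symmetric])
qed

lemma spectral_pair_imp_spectral:
  assumes "spectral_pair A L"
  shows "spectral A"
proof -
  have A: "finite A" "A \<noteq> {}" and L: "finite L" and orth: "orthogonal_on A L"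
    using assms by (auto simp: spectral_pair_def)
  interpret finite_measure "delta A"
    by (rule finite_measure_delta)
  have "L2_orthogonal_basis (delta A) expo L"
    unfolding L2_orthogonal_basis_def
  proof (intro conjI ballI impI allI)
    fix l
    show "expo l \<in> L2 (delta A)"
      by (simp add: L2_def)
    show "L2_norm (delta A) (expo l) \<noteq> 0"
      using A unfolding L2_norm_def by (subst integral_delta_real) auto
  next
    fix k l assume "k \<in> L" "l \<in> L" "k \<noteq> l"
    moreover have "expo k x * cnj (expo l x) = expo (k - l) x" for x
      by (simp add: cnj_expo expo_add_left[symmetric])
    ultimately show "L2_inner (delta A) (expo k) (expo l) = 0"
      using A orth by (simp add: L2_inner_def integral_delta orthogonal_on_def)
  next
    fix f and \<epsilon> :: real assume f: "f \<in> L2 (delta A)" and "\<epsilon> > 0"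
    define c where "c l = (\<Sum>a\<in>A. f a * expo (- l) a) / of_nat (card L)" for l
    have [measurable]: "f \<in> borel_measurable borel"
      using f measurable_cong_sets[OF sets_delta refl] by (auto simp: L2_def)
    \<comment> \<open>The expansion is exact at the points of \<open>A\<close>, and these carry the
      whole measure, so the full finite sum over \<open>L\<close> serves for every
      \<epsilon>.\<close>
    have "L2_norm (delta A) (\<lambda>x. f x - (\<Sum>l\<in>L. c l * expo l x)) = 0"
      unfolding L2_norm_def using spectral_pair_expansion[OF assms, of _ f] A
      by (subst integral_delta_real) (auto simp: c_def[symmetric])
    with \<open>\<epsilon> > 0\<close> L show "\<exists>F c. finite F \<and> F \<subseteq> L \<and>
       L2_norm (delta A) (\<lambda>x. f x - (\<Sum>i\<in>F. c i * expo i x)) < \<epsilon>"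
      by (intro exI[of _ L] exI[of _ c]) auto
  qed
  with A show ?thesis
    by (auto simp: spectral_def)
qed

section \<open>Tilings of intervals\<close>

text \<open>Trades unique existence of a pair for injectivity of addition on
  \<open>A \<times> B\<close>; later contradictions come from exhibiting two representations of one
  number.\<close>

lemma direct_sum_iff:
  "direct_sum A B C \<longleftrightarrow>
    (\<forall>a\<in>A. \<forall>b\<in>B. a + b \<in> C) \<and> (\<forall>c\<in>C. \<exists>a\<in>A. \<exists>b\<in>B. c = a + b) \<and>
    (\<forall>a\<in>A. \<forall>b\<in>B. \<forall>a'\<in>A. \<forall>b'\<in>B. a + b = a' + b' \<longrightarrow> a = a' \<and> b = b')"
  (is "_ \<longleftrightarrow> ?sums \<and> ?ex \<and> ?uniq")
proof
  assume *: "direct_sum A B C"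
  then have C: "C = {a + b | a b. a \<in> A \<and> b \<in> B}"
    and ex1: "\<And>c. c \<in> C \<Longrightarrow> \<exists>!p. p \<in> A \<times> B \<and> c = fst p + snd p"
    by (auto simp: direct_sum_def)
  have ?uniq
  proof (intro ballI impI)
    fix a b a' b' assume ab: "a \<in> A" "b \<in> B" "a' \<in> A" "b' \<in> B" "a + b = a' + b'"
    then have "a + b \<in> C"
      using C by auto
    from ex1[OF this] have "(a, b) = (a', b')"
      by (rule ex1E) (use ab in \<open>metis SigmaI fst_conv snd_conv\<close>)
    then show "a = a' \<and> b = b'"
      by simp
  qed
  with C show "?sums \<and> ?ex \<and> ?uniq"
    by blast
next
  assume *: "?sums \<and> ?ex \<and> ?uniq"
  have "\<exists>!p. p \<in> A \<times> B \<and> c = fst p + snd p" if c: "c \<in> C" for c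
  proof -
    obtain a b where ab: "a \<in> A" "b \<in> B" "c = a + b"
      using * c by blast
    moreover have "p = (a, b)" if "p \<in> A \<times> B" "c = fst p + snd p" for p
    proof -
      have "fst p \<in> A" "snd p \<in> B" "fst p + snd p = a + b"
        using that ab by auto
      then have "fst p = a \<and> snd p = b"
        using * ab(1,2) by blast
      then show ?thesis
        by (simp add: prod_eq_iff)
    qed
    ultimately show ?thesis
      by (intro ex1I[of _ "(a, b)"]) auto
  qed
  with * show "direct_sum A B C"
    unfolding direct_sum_def by blast
qed

lemma direct_sum_commute: "direct_sum A B C \<longleftrightarrow> direct_sum B A (C :: 'a::ab_semigroup_add set)"
proof -
  have "direct_sum B A C" if "direct_sum A B C" for A B C :: "'a set"
  proof -
    from that have sums: "\<forall>a\<in>A. \<forall>b\<in>B. a + b \<in> C"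
      and ex: "\<forall>c\<in>C. \<exists>a\<in>A. \<exists>b\<in>B. c = a + b"
      and uniq: "\<forall>a\<in>A. \<forall>b\<in>B. \<forall>a'\<in>A. \<forall>b'\<in>B. a + b = a' + b' \<longrightarrow> a = a' \<and> b = b'"
      unfolding direct_sum_iff by simp_all
    show ?thesis
      unfolding direct_sum_iff
    proof (intro conjI ballI impI)
      fix b a assume "b \<in> B" "a \<in> A"
      then show "b + a \<in> C"
        using sums by (subst add.commute) blast
    next
      fix c assume "c \<in> C"
      then show "\<exists>b\<in>B. \<exists>a\<in>A. c = b + a"
        using ex by (subst add.commute) blast
    next
      fix b a b' a' assume *: "b \<in> B" "a \<in> A" "b' \<in> B" "a' \<in> A" "b + a = b' + a'"
      then have "a + b = a' + b'"
        by (simp only: add.commute)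
      with * uniq show "b = b'" "a = a'"
        by blast+
    qed
  qed
  then show ?thesis
    by blast
qed

section \<open>De Bruijn's block structure of a tiling\<close>

context
  fixes A B :: "int set" and n :: int
  assumes tiling: "direct_sum A B {0..<n}"
    and A_nonneg: "A \<subseteq> {0..}" and B_nonneg: "B \<subseteq> {0..}"
    and zero_in_A: "0 \<in> A" and zero_in_B: "0 \<in> B"
begin

lemma tiling_sum: "a \<in> A \<Longrightarrow> b \<in> B \<Longrightarrow> 0 \<le> a + b \<and> a + b < n"
  using tiling by (auto simp: direct_sum_iff)

lemma tiling_ex:
  assumes "0 \<le> c" "c < n"
  obtains a b where "a \<in> A" "b \<in> B" "0 \<le> a" "0 \<le> b" "c = a + b"
proof -
  obtain a b where "a \<in> A" "b \<in> B" "c = a + b"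
    using tiling assms unfolding direct_sum_iff by (metis atLeastLessThan_iff)
  then show ?thesis
    using A_nonneg B_nonneg by (intro that) auto
qed

lemma tiling_unique:
  "a \<in> A \<Longrightarrow> b \<in> B \<Longrightarrow> a' \<in> A \<Longrightarrow> b' \<in> B \<Longrightarrow> a + b = a' + b' \<Longrightarrow> a = a' \<and> b = b'"
  using tiling[unfolded direct_sum_iff, THEN conjunct2, THEN conjunct2] by simp

text \<open>Here \<open>m\<close> is the length of the initial run of \<open>A\<close>.\<close>

lemma tiling_blocks_aux:
  fixes m :: int and q :: nat
  assumes m: "m > 0" "m \<in> B" and run: "{0..<m} \<subseteq> A" and r: "0 \<le> r" "r < m"
  shows "(int q * m + r \<in> A \<longleftrightarrow> int q * m \<in> A) \<and> (int q * m + r \<in> B \<longrightarrow> r = 0)"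
  using r
proof (induction q arbitrary: r rule: less_induct)
  \<comment> \<open>Strong induction on the block index: in a representation \<open>a + b\<close> of
    a point of block \<open>q\<close>, a nonzero multiple \<open>b\<close> of \<open>m\<close> puts
    \<open>a\<close> into an earlier block.\<close>
  case (less q r)
  have B_mult: "\<exists>k. b = int k * m" if "b \<in> B" "b < int q * m" for b
  proof -
    define k where "k = nat (b div m)"
    have b: "b = int k * m + b mod m" "0 \<le> b mod m" "b mod m < m"
      using that B_nonneg m by (auto simp: k_def pos_imp_zdiv_nonneg_iff)
    then have "int k * m < int q * m"
      using that by linarith
    then have "k < q"
      using m by (simp add: mult_less_cancel_right)
    then show ?thesis
      using less.IH[of k "b mod m"] b that by auto
  qed
  show ?case
  proof (cases "int q * m \<in> A")
    case True
    \<comment> \<open>For \<open>s > 0\<close> the number \<open>q m + m\<close> would be both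
      \<open>(q m) + m\<close> and \<open>(m - s) + (q m + s)\<close>, forcing
      \<open>q m = m - s\<close>, which lies strictly between \<open>0\<close> and
      \<open>m\<close>.\<close>
    have B_block: "s = 0" if "int q * m + s \<in> B" "0 \<le> s" "s < m" for s
    proof (rule ccontr)
      assume "s \<noteq> 0"
      then have "m - s \<in> A"
        using that run by auto
      from tiling_unique[OF True m(2) this that(1)] have "int q * m = m - s"
        by simp
      then have "int q * m < m" "int q * m > 0"
        using that \<open>s \<noteq> 0\<close> by auto
      then show False
        using m by (auto simp: mult_less_cancel_right1 zero_less_mult_iff)
    qed
    have "int q * m + r \<in> A"
    proof -
      \<comment> \<open>The block fits into the interval because \<open>q m + m\<close> is a sum
        from \<open>A\<close> and \<open>B\<close>.\<close>
      have "int q * m + r < n" "0 \<le> int q * m + r"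
        using tiling_sum[OF True m(2)] less.prems m by auto
      then obtain a b where ab: "a \<in> A" "b \<in> B" "0 \<le> a" "0 \<le> b" "int q * m + r = a + b"
        using tiling_ex by metis
      have "\<exists>k. b = int k * m"
      proof (cases "b < int q * m")
        case False
        then show ?thesis
          using B_block[of "b - int q * m"] ab less.prems by auto
      qed (use B_mult ab in blast)
      then obtain k where k: "b = int k * m" ..
      \<comment> \<open>Otherwise \<open>a\<close> lies in block \<open>q - k\<close> at offset
        \<open>r\<close>, so by induction \<open>A\<close> contains the start of that block. Adding
        \<open>b\<close> to this start gives a second representation of \<open>q m\<close>.\<close>
      have "k = 0"
      proof (rule ccontr)
        assume "k \<noteq> 0"
        have "int k * m < (int q + 1) * m"
          using ab k less.prems by (simp add: algebra_simps)
        then have "k \<le> q"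
          using m by (simp add: mult_less_cancel_right)
        then have a: "a = int (q - k) * m + r"
          using ab k by (simp add: of_nat_diff algebra_simps)
        then have "int (q - k) * m \<in> A"
          using less.IH[of "q - k" r] less.prems ab \<open>k \<noteq> 0\<close> \<open>k \<le> q\<close> by auto
        moreover have "int (q - k) * m + b = int q * m + 0"
          using k \<open>k \<le> q\<close> by (simp add: of_nat_diff algebra_simps)
        ultimately have "b = 0"
          using tiling_unique[OF _ ab(2) True zero_in_B] by blast
        then show False
          using k \<open>k \<noteq> 0\<close> m by simp
      qed
      then show ?thesis
        using ab k by simp
    qed
    then show ?thesis
      using True B_block less.prems by blast
  next
    case False
    have "q > 0"
      using False zero_in_A by (cases q) auto
    text \<open>The cell \<open>q m\<close> is covered by a proper translate, which covers the whole block.\<close>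
    have cover: "\<exists>a\<in>A. \<exists>b\<in>B. a > 0 \<and> b > 0 \<and> int q * m + r = a + b"
      if less_n: "int q * m < n" and "r > 0"
    proof -
      have "0 \<le> int q * m"
        using m by simp
      then obtain a b where ab: "a \<in> A" "b \<in> B" "0 \<le> a" "0 \<le> b" "int q * m = a + b"
        using tiling_ex[OF _ less_n] by blast
      have "b \<noteq> 0"
        using False ab by auto
      have "\<exists>k. b = int k * m"
        using B_mult[of b] ab by (cases "b < int q * m") auto
      then obtain k where k: "b = int k * m" ..
      then have "k \<noteq> 0" "int k * m \<le> int q * m"
        using \<open>b \<noteq> 0\<close> ab by auto
      then have "k \<le> q"
        using m by (simp add: mult_le_cancel_right)
      then have a: "a = int (q - k) * m"
        using ab k by (simp add: of_nat_diff algebra_simps)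
      then have "a + r \<in> A"
        using less.IH[of "q - k" r] less.prems ab \<open>k \<noteq> 0\<close> \<open>q > 0\<close> by auto
      then show ?thesis
        using ab \<open>b \<noteq> 0\<close> that by (intro bexI[of _ "a + r"] bexI[of _ b]) auto
    qed
    \<comment> \<open>A point of \<open>A\<close> or of \<open>B\<close> inside the block at a
      positive offset would be itself plus zero and also the sum of two positive summands supplied
      by \<open>cover\<close>.\<close>
    have "r = 0" if r_in: "int q * m + r \<in> A"
    proof (rule ccontr)
      assume "r \<noteq> 0"
      then obtain a b where ab: "a \<in> A" "b \<in> B" "b > 0" "int q * m + r = a + b"
        using cover tiling_sum[OF r_in zero_in_B] less.prems by force
      then show False
        using tiling_unique[OF r_in zero_in_B ab(1,2)] by simp
    qed
    moreover have "r = 0" if r_in: "int q * m + r \<in> B"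
    proof (rule ccontr)
      assume "r \<noteq> 0"
      then obtain a b where ab: "a \<in> A" "b \<in> B" "a > 0" "int q * m + r = a + b"
        using cover tiling_sum[OF zero_in_A r_in] less.prems by force
      then show False
        using tiling_unique[OF zero_in_A r_in ab(1,2)] by simp
    qed
    ultimately show ?thesis
      using False by auto
  qed
qed

text \<open>Let \<open>m\<close> be the least nonnegative integer outside \<open>A\<close>. If
  \<open>m = n\<close>, then \<open>A\<close> is the whole interval and \<open>B\<close> is
  \<open>{0}\<close>. Otherwise write \<open>m = a + b\<close>: if \<open>a > 0\<close>, then
  \<open>0 < b < m\<close> lies in both \<open>A\<close> and \<open>B\<close>, so \<open>b\<close>
  has two representations; hence \<open>m\<close> is in \<open>B\<close> and the block analysis
  applies.\<close>

lemma tiling_blocks: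
  assumes "1 \<in> A"
  obtains m where "m \<ge> 2" "m \<le> n" "\<And>x. x \<in> A \<longleftrightarrow> x - x mod m \<in> A" "\<And>x. x \<in> B \<Longrightarrow> m dvd x"
proof -
  have A_less: "a < n" if "a \<in> A" for a
    using tiling_sum[OF that zero_in_B] by simp
  define P where "P k \<longleftrightarrow> int k \<notin> A" for k
  define k where "k = (LEAST k. P k)"
  define m where "m = int k"
  have "P (nat n)"
    using A_less[of "int (nat n)"] tiling_sum[OF zero_in_A zero_in_B] unfolding P_def by auto
  then have "P k" and k_le: "k \<le> nat n" and min: "\<And>j. j < k \<Longrightarrow> \<not> P j"
    unfolding k_def by (auto intro: LeastI Least_le dest: not_less_Least)
  have mA: "m \<notin> A"
    using \<open>P k\<close> by (simp add: P_def m_def)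
  have run: "{0..<m} \<subseteq> A"
  proof
    fix x assume "x \<in> {0..<m}"
    then show "x \<in> A"
      using min[of "nat x"] by (auto simp: P_def m_def)
  qed
  have "m \<noteq> 0" "m \<noteq> 1"
    using mA assms zero_in_A by auto
  then have m2: "m \<ge> 2"
    by (simp add: m_def)
  have mn: "m \<le> n"
    using k_le m2 by (simp add: m_def)
  show ?thesis
  proof (cases "m = n")
    case True
    have "b = 0" if "b \<in> B" for b
    proof -
      have "0 \<le> b" "b < n"
        using that B_nonneg tiling_sum[OF zero_in_A that] by auto
      then have "b \<in> A"
        using run True by auto
      then show ?thesis
        using tiling_unique[OF _ zero_in_B zero_in_A that] by simp
    qed
    moreover have A_eq: "A = {0..<m}"
      using run True A_less A_nonneg by force
    moreover have "x \<in> A \<longleftrightarrow> x - x mod m \<in> A" for x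
    proof -
      have "x - x mod m \<in> A \<longleftrightarrow> x div m = 0"
        using m2 mult_less_cancel_left1[of m "x div m"] unfolding A_eq minus_mod_eq_mult_div
        by (auto simp: zero_le_mult_iff)
      also have "\<dots> \<longleftrightarrow> x \<in> A"
        using m2 by (auto simp: A_eq zdiv_eq_0_iff)
      finally show ?thesis ..
    qed
    ultimately show ?thesis
      using m2 mn by (intro that) auto
  next
    case False
    have "m \<in> B"
    proof -
      obtain a b where ab: "a \<in> A" "b \<in> B" "0 \<le> a" "0 \<le> b" "m = a + b"
        using tiling_ex[of m] m2 mn False by auto
      have "b \<noteq> 0"
        using ab mA by auto
      have "a = 0"
      proof (rule ccontr)
        assume "a \<noteq> 0"
        then have "b \<in> A"
          using ab run by auto
        then show False
          using tiling_unique[OF _ zero_in_B zero_in_A ab(2)] \<open>b \<noteq> 0\<close> by simp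
      qed
      with ab show ?thesis
        by simp
    qed
    note blocks = tiling_blocks_aux[OF _ this run]
    show ?thesis
    proof (rule that[OF m2 mn])
      fix x
      \<comment> \<open>Block indices are natural numbers, so negative \<open>x\<close> are excluded
        separately: rounding down to a multiple of \<open>m\<close> keeps them negative.\<close>
      have x: "int (nat (x div m)) * m + x mod m = x" "0 \<le> x mod m" "x mod m < m" if "0 \<le> x"
        using that m2 by (auto simp: pos_imp_zdiv_nonneg_iff)
      have "0 \<le> x" if "x - x mod m \<in> A"
        using subsetD[OF A_nonneg that] m2 pos_mod_sign[of m x] unfolding atLeast_iff by linarith
      moreover have "x \<in> A \<longleftrightarrow> x - x mod m \<in> A" if "0 \<le> x"
      proof -
        have "int (nat (x div m)) * m = x - x mod m"
          using x(1)[OF that] by linarith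
        then show ?thesis
          using blocks[of "x mod m" "nat (x div m)"] x[OF that] m2 by simp
      qed
      ultimately show "x \<in> A \<longleftrightarrow> x - x mod m \<in> A"
        using A_nonneg unfolding subset_iff atLeast_iff by blast
      show "m dvd x" if "x \<in> B"
      proof -
        have "0 \<le> x"
          using that B_nonneg by auto
        then have "x mod m = 0"
          using blocks[of "x mod m" "nat (x div m)"] that m2 unfolding x(1)[OF \<open>0 \<le> x\<close>] by simp
        then show ?thesis
          by (simp add: dvd_eq_mod_eq_0)
      qed
    qed
  qed
qed

text \<open>As \<open>A\<close> is a union of blocks of length \<open>m\<close> and \<open>B\<close>
  consists of multiples of \<open>m\<close>, the multiples of \<open>m\<close> in the interval are
  tiled by those in \<open>A\<close> together with \<open>B\<close>. Division by \<open>m\<close>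
  gives the shorter tiling.\<close>

lemma tiling_reduce:
  assumes "1 \<in> A"
  obtains m A' B' n' where "m \<ge> 2" "0 < n'" "n' < n" "A = sumset {0..<m} ((*) m ` A')"
    "B = (*) m ` B'" "direct_sum A' B' {0..<n'}" "A' \<subseteq> {0..}" "B' \<subseteq> {0..}" "0 \<in> A'" "0 \<in> B'"
proof -
  obtain m where m: "m \<ge> 2" "m \<le> n" and blocks: "\<And>x. x \<in> A \<longleftrightarrow> x - x mod m \<in> A"
    and dvd: "\<And>x. x \<in> B \<Longrightarrow> m dvd x"
    using tiling_blocks[OF assms] by metis
  define A' B' where "A' = {a. m * a \<in> A}" and "B' = {b. m * b \<in> B}"
  \<comment> \<open>This is \<open>n / m\<close> rounded up, the number of multiples of
    \<open>m\<close> in \<open>{0..<n}\<close>.\<close>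
  define n' where "n' = (n - 1) div m + 1"
  have less: "c < n' \<longleftrightarrow> m * c < n" for c
  proof -
    have "c \<le> (n - 1) div m \<longleftrightarrow> c * m \<le> n - 1"
    proof
      assume "c \<le> (n - 1) div m"
      then have "c * m \<le> (n - 1) div m * m"
        using m by (intro mult_right_mono) auto
      also have "\<dots> \<le> n - 1"
        using m pos_mod_sign[of m "n - 1"] by (simp add: minus_mod_eq_div_mult[symmetric] del: pos_mod_sign)
      finally show "c * m \<le> n - 1" .
    next
      assume "c * m \<le> n - 1"
      then show "c \<le> (n - 1) div m"
        using m zdiv_mono1[of "c * m" "n - 1" m] by simp
    qed
    then have "c < n' \<longleftrightarrow> c * m \<le> n - 1"
      unfolding n'_def by linarith
    then show ?thesis
      by (auto simp: mult.commute)
  qed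
  have nonneg: "0 \<le> c \<longleftrightarrow> 0 \<le> m * c" for c
    using m by (simp add: zero_le_mult_iff)
  show ?thesis
  proof
    show "0 < n'"
      using less[of 0] m by simp
    have "(n - 1) div m < n - 1"
      using m by (intro int_div_less_self) auto
    then show "n' < n"
      by (simp add: n'_def)
    show "B = (*) m ` B'"
      using dvd by (auto simp: B'_def elim!: dvdE)
    show "A = sumset {0..<m} ((*) m ` A')"
    proof (intro set_eqI iffI)
      fix x assume "x \<in> A"
      then have "x div m \<in> A'"
        using blocks[of x] by (simp add: A'_def minus_mod_eq_mult_div)
      then show "x \<in> sumset {0..<m} ((*) m ` A')"
        unfolding sumset_def using m by (intro image_eqI[of x _ "(x mod m, m * (x div m))"]) auto
    next
      fix x assume "x \<in> sumset {0..<m} ((*) m ` A')"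
      then obtain i a where "x = i + m * a" "0 \<le> i" "i < m" "m * a \<in> A"
        by (auto simp: sumset_def A'_def)
      then show "x \<in> A"
        using blocks[of x] by simp
    qed
    show "direct_sum A' B' {0..<n'}"
      unfolding direct_sum_iff
    proof (intro conjI ballI impI)
      fix a b assume "a \<in> A'" "b \<in> B'"
      then show "a + b \<in> {0..<n'}"
        using tiling_sum[of "m * a" "m * b"] nonneg[of "a + b"] less[of "a + b"]
        by (simp add: A'_def B'_def distrib_left)
    next
      fix c assume "c \<in> {0..<n'}"
      then have "0 \<le> m * c" "m * c < n"
        using nonneg less by auto
      then obtain a b where ab: "a \<in> A" "b \<in> B" "m * c = a + b"
        by (rule tiling_ex)
      then obtain b' where b': "b = m * b'"
        using dvd by (auto elim!: dvdE)
      \<comment> \<open>Both \<open>m * c\<close> and \<open>b\<close> are multiples of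
        \<open>m\<close>, hence so is \<open>a\<close>.\<close>
      then have "a = m * (c - b')"
        using ab by (simp add: algebra_simps)
      then show "\<exists>a\<in>A'. \<exists>b\<in>B'. c = a + b"
        using ab b' by (intro bexI[of _ "c - b'"] bexI[of _ b']) (auto simp: A'_def B'_def)
    next
      fix a b a' b' assume *: "a \<in> A'" "b \<in> B'" "a' \<in> A'" "b' \<in> B'" and "a + b = a' + b'"
      then have "m * a + m * b = m * a' + m * b'"
        by (metis distrib_left)
      from tiling_unique[OF _ _ _ _ this] * show "a = a'" "b = b'"
        using m by (auto simp: A'_def B'_def)
    qed
    show "A' \<subseteq> {0..}" "B' \<subseteq> {0..}"
      using A_nonneg B_nonneg nonneg by (auto simp: A'_def B'_def)
  qed (use m zero_in_A zero_in_B in \<open>auto simp: A'_def B'_def\<close>)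
qed

end

section \<open>Descent on the length of the interval\<close>

text \<open>The frequencies \<open>j / m\<close> are trivial on \<open>m A\<close> because
  \<open>A\<close> consists of integers; this is the cross condition of
  \<open>spectral_pair_sumset\<close>.\<close>

lemma spectral_pair_interval_sumset:
  fixes m :: int
  assumes "spectral_pair (of_int ` A) L" "m > 0"
  shows "\<exists>L. spectral_pair (of_int ` sumset {0..<m} ((*) m ` A)) L"
proof -
  define k where "k = nat m"
  have k: "k > 0" "m = int k"
    using assms(2) by (auto simp: k_def)
  have "spectral_pair (sumset (real ` {..<k}) ((*) (real k) ` of_int ` A))
    (sumset ((\<lambda>j. real j / real k) ` {..<k}) ((*) (1 / real k) ` L))"
    using assms(1) k
    by (intro spectral_pair_sumset spectral_pair_interval spectral_pair_scale)
      (auto simp: expo_eq_1_iff)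
  moreover have "real_of_int ` {0..<m} = real ` {..<k}"
  proof -
    have "{0..<m} = int ` {..<k}"
      using k by (simp add: image_int_atLeastLessThan lessThan_atLeast0)
    then show ?thesis
      by (simp add: image_image)
  qed
  moreover have "real_of_int ` sumset X Y = sumset (real_of_int ` X) (real_of_int ` Y)" for X Y
    by (force simp: sumset_def)
  moreover have "real_of_int ` (*) m ` A = (*) (real k) ` of_int ` A"
    using k by (simp add: image_image)
  ultimately show ?thesis
    by auto
qed

lemma spectral_pair_int_scale:
  fixes m :: int
  assumes "spectral_pair (of_int ` A) L" "m > 0"
  shows "\<exists>L. spectral_pair (of_int ` (*) m ` A) L"
proof -
  have "real_of_int ` (*) m ` A = (*) (of_int m) ` of_int ` A"
    by (simp add: image_image)
  then show ?thesis
    using spectral_pair_scale[OF assms(1), of "of_int m"] assms(2) by auto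
qed

text \<open>Induction on \<open>n\<close>. For \<open>n > 1\<close> the number \<open>1\<close> is a
  sum of nonnegative elements of \<open>A\<close> and \<open>B\<close>, so it belongs to one of
  them, and \<open>tiling_reduce\<close> applies to the tiling or to the tiling with its factors
  exchanged.\<close>

lemma tiling_imp_spectral_pair:
  fixes A B :: "int set"
  assumes "direct_sum A B {0..<n}" "A \<subseteq> {0..}" "B \<subseteq> {0..}" "0 \<in> A" "0 \<in> B"
  shows "\<exists>L. spectral_pair (of_int ` A) L"
  using assms
proof (induction "nat n" arbitrary: n A B rule: less_induct)
  case less
  note tiling = less.prems
  have "n > 0"
    using tiling_sum[OF tiling tiling(4,5)] by simp
  show ?case
  proof (cases "n = 1")
    case True
    then have "A = {0}"
      using tiling_sum[OF tiling _ tiling(5)] tiling(4) by force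
    then show ?thesis
      using spectral_pair_singleton by auto
  next
    case False
    then obtain a b where "a \<in> A" "b \<in> B" "0 \<le> a" "0 \<le> b" "1 = a + b"
      using tiling_ex[OF tiling, of 1] \<open>n > 0\<close> by auto
    then consider "1 \<in> A" | "1 \<in> B"
      by (cases "a = 0") (auto simp: order_le_less)
    then show ?thesis
    proof cases
      case 1
      then obtain m A' B' n' where *: "m \<ge> 2" "0 < n'" "n' < n"
        "A = sumset {0..<m} ((*) m ` A')" "direct_sum A' B' {0..<n'}"
        "A' \<subseteq> {0..}" "B' \<subseteq> {0..}" "0 \<in> A'" "0 \<in> B'"
        by (rule tiling_reduce[OF tiling])
      then obtain L where "spectral_pair (of_int ` A') L"
        using less.hyps[of n' A' B'] by auto
      then show ?thesis
        using spectral_pair_interval_sumset[of A' L m] * by simp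
    next
      case 2
      \<comment> \<open>After the exchange \<open>A\<close> is the factor made of multiples of
        \<open>m\<close>, so it is merely a dilate of the smaller set.\<close>
      have "direct_sum B A {0..<n}"
        using tiling(1) by (simp add: direct_sum_commute)
      from tiling_reduce[OF this tiling(3,2,5,4) 2]
      obtain m A' B' n' where *: "m \<ge> 2" "0 < n'" "n' < n" "A = (*) m ` A'"
        "direct_sum B' A' {0..<n'}" "A' \<subseteq> {0..}" "B' \<subseteq> {0..}" "0 \<in> A'" "0 \<in> B'"
        by metis
      then obtain L where "spectral_pair (of_int ` A') L"
        using less.hyps[of n' A' B'] by (auto simp: direct_sum_commute)
      then show ?thesis
        using spectral_pair_int_scale[of A' L m] * by simp
    qed
  qed
qed

text \<open>Opposite shifts cancel in every sum \<open>a + b\<close>.\<close>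

lemma direct_sum_translate:
  fixes t :: "'a::ab_group_add"
  assumes "direct_sum A B C"
  shows "direct_sum ((+) (- t) ` A) ((+) t ` B) C"
proof -
  have "- t + a + (t + b) = a + b" for a b
    by (simp only: add.assoc add.left_commute[of a t] minus_add_cancel)
  then show ?thesis
    using assms by (simp only: direct_sum_iff Set.ball_simps Set.bex_simps add_left_cancel)
qed

theorem theorem3p29:
  fixes A :: "int set"
  assumes "A \<subseteq> {0..}"
    and "\<exists>(B :: int set) (n :: nat). n \<ge> 1 \<and> direct_sum A B {0..int n - 1}"
  shows "spectral (real_of_int ` A)"
proof -
  obtain B n where n: "n \<ge> 1" and *: "direct_sum A B {0..int n - 1}"
    using assms(2) by blast
  have "{0..int n - 1} = {0..<int n}"
    by auto
  with * have tiling: "direct_sum A B {0..<int n}"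
    by simp
  then have sums: "\<forall>x\<in>A. \<forall>y\<in>B. x + y \<in> {0..<int n}"
    and ex: "\<forall>c\<in>{0..<int n}. \<exists>a\<in>A. \<exists>b\<in>B. c = a + b"
    unfolding direct_sum_iff by simp_all
  have "0 \<in> {0..<int n}"
    using n by simp
  \<comment> \<open>The representation of \<open>0\<close> fixes the shift: moving \<open>A\<close>
    by \<open>- a = b\<close> and \<open>B\<close> by \<open>a\<close> puts \<open>0\<close> into
    both, and every shifted element is a sum from \<open>A\<close> and \<open>B\<close>, hence
    nonnegative.\<close>
  then obtain a b where ab: "a \<in> A" "b \<in> B" "0 = a + b"
    using ex by blast
  have nonneg: "0 \<le> x + y" if "x \<in> A" "y \<in> B" for x y
    using sums that by simp
  have "b = - a"
    using ab by simp
  have "direct_sum ((+) (- a) ` A) ((+) a ` B) {0..<int n}"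
    using tiling by (rule direct_sum_translate)
  then have "\<exists>L. spectral_pair (of_int ` (+) (- a) ` A) L"
  proof (rule tiling_imp_spectral_pair)
    show "(+) (- a) ` A \<subseteq> {0..}"
      using nonneg[OF _ ab(2)] \<open>b = - a\<close> by force
    show "(+) a ` B \<subseteq> {0..}"
      using nonneg[OF ab(1)] by force
  qed (use ab \<open>b = - a\<close> in force)+
  then obtain L where "spectral_pair (of_int ` (+) (- a) ` A) L" ..
  then have "spectral_pair ((+) (of_int a) ` of_int ` (+) (- a) ` A) L"
    by (rule spectral_pair_translate)
  moreover have "(+) (of_int a) ` of_int ` (+) (- a) ` A = real_of_int ` A"
    by (simp add: image_image)
  ultimately show ?thesis
    using spectral_pair_imp_spectral by metis
qed

end
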